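(* Let $0\le\alpha\le 1$ and $\beta\ge 0$ be real numbers, and let $f\in\mathcal{A}$ satisfy $f(z)f'(z)/z\neq 0$ for all $z\in\mathbb{D}$. If at least one of the following inequalities holds for all $z\in\mathbb{D}$: (i) $\operatorname{Re}\big(\alpha Q_{ST}+(1-\alpha)Q_{ST}^2+\beta Q_{SD}Q_{CV}\big)>0$; (ii) $\operatorname{Re}\big(\alpha Q_{ST}+(1-\alpha)Q_{ST}^2+\beta Q_{SD}Q_{ST}\big)>0$; (iii) $\operatorname{Re}\big(\alpha Q_{ST}+(1-\alpha)Q_{CV}^2+\beta Q_{SD}Q_{ST}\big)>0$; (iv) $\operatorname{Re}\big(\alpha Q_{CV}+(1-\alpha)Q_{ST}^2+\beta Q_{SD}Q_{ST}\big)>0$; (v) $\operatorname{Re}\big(\alpha Q_{CV}+(1-\alpha)Q_{CV}^2+\beta Q_{SD}Q_{CV}\big)>0$; (vi) $\operatorname{Re}\big(\alpha Q_{CV}+(1-\alpha)Q_{ST}^2+\beta Q_{SD}Q_{CV}\big)>0$; (vii) $\operatorname{Re}\big(\alpha Q_{ST}+(1-\alpha)Q_{CV}^2+\beta Q_{SD}Q_{CV}\big)>0$; (viii) $\operatorname{Re}\big(\alpha Q_{CV}+(1-\alpha)Q_{CV}^2+\beta Q_{SD}Q_{ST}\big)>0$; then $f$ is starlike.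
   Context: $\mathbb{D}=\{z\in\mathbb{C}:|z|<1\}$. $\mathcal{A}$ is the class of analytic functions $f:\mathbb{D}\to\mathbb{C}$ with $f(0)=0$ and $f'(0)=1$. For $f\in\mathcal{A}$, as functions of $z\in\mathbb{D}$: $Q_{ST}=zf'(z)/f(z)$ (with the removable singularity at $z=0$ filled in, value $1$), $Q_{CV}=1+zf''(z)/f'(z)$, and $Q_{SD}=z^2\Big(\big(f''(z)/f'(z)\big)'-\tfrac12\big(f''(z)/f'(z)\big)^2\Big)$ ($z^2$ times the Schwarzian derivative of $f$). The condition $f(z)f'(z)/z\neq0$ is understood at $z=0$ via the removable singularity (where the value is $1$). A function $f\in\mathcal{A}$ is starlike if $\operatorname{Re}Q_{ST}>0$ on $\mathbb{D}$; equivalently, $f$ is univalent and $tf(z)\in f(\mathbb{D})$ for all $z\in\mathbb{D}$, $t\in[0,1]$. *)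

theory Defs
  imports "HOL-Complex_Analysis.Complex_Analysis"
begin

abbreviation unit_disc :: "complex set" where
  "unit_disc \<equiv> ball 0 1"

text \<open>Functions on the disc are total functions on \<^typ>\<open>complex\<close> of which only the values on the
  disc matter: the disc is open, so \<^const>\<open>deriv\<close> at its points does not see the values outside.\<close>

definition class_A :: "(complex \<Rightarrow> complex) set" where
  "class_A = {f. f holomorphic_on unit_disc \<and> f 0 = 0 \<and> deriv f 0 = 1}"

text \<open>The value at 0 fills in the removable singularity; see \<open>Q_ST_tendsto_0\<close> below.\<close>

definition Q_ST :: "(complex \<Rightarrow> complex) \<Rightarrow> complex \<Rightarrow> complex" where
  "Q_ST f z = (if z = 0 then 1 else z * deriv f z / f z)"

definition Q_CV :: "(complex \<Rightarrow> complex) \<Rightarrow> complex \<Rightarrow> complex" where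
  "Q_CV f z = 1 + z * deriv (deriv f) z / deriv f z"

definition schwarzian :: "(complex \<Rightarrow> complex) \<Rightarrow> complex \<Rightarrow> complex" where
  "schwarzian f z =
     deriv (\<lambda>w. deriv (deriv f) w / deriv f w) z
       - 1 / 2 * (deriv (deriv f) z / deriv f z)\<^sup>2"

definition Q_SD :: "(complex \<Rightarrow> complex) \<Rightarrow> complex \<Rightarrow> complex" where
  "Q_SD f z = z\<^sup>2 * schwarzian f z"

text \<open>The function \<open>f(z) f'(z) / z\<close>, with its removable singularity at 0 filled in;
  see \<open>ff'_over_z_tendsto_0\<close> below.\<close>

definition ff'_over_z :: "(complex \<Rightarrow> complex) \<Rightarrow> complex \<Rightarrow> complex" where
  "ff'_over_z f z = (if z = 0 then 1 else f z * deriv f z / z)"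

text \<open>If \<open>f\<close> has a zero other than 0, then \<^const>\<open>Q_ST\<close> takes the value 0 there
  (division by zero), so \<open>f\<close> is not starlike, as it should be. Not to be confused with the
  library's \<^const>\<open>starlike\<close>, a property of sets.\<close>

definition starlike_fun :: "(complex \<Rightarrow> complex) \<Rightarrow> bool" where
  "starlike_fun f \<longleftrightarrow> f \<in> class_A \<and> (\<forall>z\<in>unit_disc. Re (Q_ST f z) > 0)"

lemma class_A_tendsto_0:
  assumes "f \<in> class_A"
  shows "(\<lambda>z. f z / z) \<midarrow>0\<rightarrow> 1" and "deriv f \<midarrow>0\<rightarrow> 1"
proof -
  have f: "f holomorphic_on unit_disc" "f 0 = 0" "deriv f 0 = 1"
    using assms by (auto simp: class_A_def)
  have "(f has_field_derivative 1) (at 0)"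
    using holomorphic_derivI[OF f(1), of 0] f(3) by simp
  then show "(\<lambda>z. f z / z) \<midarrow>0\<rightarrow> 1"
    using f(2) by (simp add: has_field_derivative_iff)
  have "deriv f holomorphic_on unit_disc"
    using f(1) by (intro holomorphic_deriv) auto
  then have "isCont (deriv f) 0"
    using holomorphic_on_imp_continuous_on continuous_on_interior[of unit_disc "deriv f" 0] by auto
  then show "deriv f \<midarrow>0\<rightarrow> 1"
    using f(3) by (simp add: isCont_def)
qed

lemma Q_ST_tendsto_0:
  assumes "f \<in> class_A"
  shows "Q_ST f \<midarrow>0\<rightarrow> Q_ST f 0"
proof -
  have "(\<lambda>z. deriv f z / (f z / z)) \<midarrow>0\<rightarrow> 1 / 1"
    using class_A_tendsto_0[OF assms] by (intro tendsto_divide) auto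
  moreover have "\<forall>\<^sub>F z in at 0. deriv f z / (f z / z) = Q_ST f z"
    by (auto simp: eventually_at_filter Q_ST_def)
  ultimately show ?thesis
    using tendsto_cong by (fastforce simp: Q_ST_def)
qed

lemma ff'_over_z_tendsto_0:
  assumes "f \<in> class_A"
  shows "ff'_over_z f \<midarrow>0\<rightarrow> ff'_over_z f 0"
proof -
  have "(\<lambda>z. deriv f z * (f z / z)) \<midarrow>0\<rightarrow> 1 * 1"
    using class_A_tendsto_0[OF assms] by (intro tendsto_mult) auto
  moreover have "\<forall>\<^sub>F z in at 0. deriv f z * (f z / z) = ff'_over_z f z"
    by (auto simp: eventually_at_filter ff'_over_z_def)
  ultimately show ?thesis
    using tendsto_cong by (fastforce simp: ff'_over_z_def)
qed

end

theory Submission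
  imports Defs
begin

text \<open>Write \<open>p = Q_ST f\<close>. It is holomorphic on the disc with \<open>p 0 = 1\<close>, and away from 0 the
  other two quantities are expressions in \<open>p\<close> and its derivatives:
  \<open>Q_CV f = p + z p' / p\<close> and \<open>Q_SD f = z (Q_CV f)' + (1 - (Q_CV f)\<^sup>2) / 2\<close>.

  Suppose that \<open>Re p > 0\<close> fails somewhere, and let \<open>z\<close> be a point of least modulus with
  \<open>Re p z \<le> 0\<close>. Then \<open>Re p z = 0\<close> while \<open>Re p \<ge> 0\<close> on the closed disc of radius \<open>|z|\<close>.
  So \<open>Re p\<close>, restricted to the circle through \<open>z\<close>, has a minimum at \<open>z\<close>, and restricted to
  the radius that ends in \<open>z\<close> it has a minimum at that end. This yields the qualitative part of
  the Miller--Mocanu lemma: \<open>z p'\<close> is real and \<open>\<le> 0\<close> at \<open>z\<close> (first derivatives), and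
  \<open>Re (z p' + z\<^sup>2 p'') \<le> 0\<close> there (second derivative along the circle);
  see \<open>derivatives_at_minimum_of_Re\<close>.

  With \<open>p z = i \<rho>\<close> and \<open>z p' = \<sigma>\<close>, the number \<open>Q_CV f z = i (\<rho> - \<sigma> / \<rho>)\<close> is also
  imaginary, and its imaginary part has the sign of \<open>\<rho>\<close>. The imaginary part of
  \<open>Q_SD f z\<close> comes only from the term \<open>(z p' + z\<^sup>2 p'') / p\<close>, and so both \<open>Q_SD Q_ST\<close> and
  \<open>Q_SD Q_CV\<close> have real part \<open>\<le> 0\<close> at \<open>z\<close>; see \<open>Q_values_at_first_zero\<close>.
  In each of the eight expressions the linear term is then imaginary, the squared term is
  the square of an imaginary number, and the last term has real part \<open>\<le> 0\<close>. So none of the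
  eight inequalities holds at \<open>z\<close>.\<close>

section \<open>The first point where a real part vanishes\<close>

lemma second_derivative_test_at_minimum:
  fixes g g' :: "real \<Rightarrow> real"
  assumes min: "\<And>t. g 0 \<le> g t"
    and g: "\<And>t. (g has_field_derivative g' t) (at t)"
    and g': "(g' has_field_derivative d) (at 0)"
  shows "g' 0 = 0" and "0 \<le> d"
proof -
  show g0: "g' 0 = 0"
    using DERIV_local_min[OF g, of 1 0] min by auto
  show "0 \<le> d"
  proof (rule ccontr)
    assume "\<not> 0 \<le> d"
    then obtain e where e: "e > 0" and neg: "\<And>h. 0 < h \<Longrightarrow> h < e \<Longrightarrow> g' h < g' 0"
      using DERIV_neg_dec_right[OF g'] by (auto simp: not_le)
    obtain t where "0 < t" "t < e / 2" and "g (e / 2) - g 0 = (e / 2 - 0) * g' t"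
      using MVT2[of 0 "e / 2" g g'] e g by auto
    moreover have "(e / 2) * g' t < 0"
      using neg[of t] g0 \<open>0 < t\<close> \<open>t < e / 2\<close> e by (intro mult_pos_neg) auto
    ultimately show False
      using min[of "e / 2"] by simp
  qed
qed

text \<open>A point of least modulus in \<open>{Re p \<le> 0}\<close> will do: \<open>Re p\<close> is positive on the open disc inside,
  so by continuity it is nonnegative on the closed one, and thus 0 at the point itself.\<close>

lemma first_zero_of_Re:
  assumes cont: "continuous_on unit_disc p" and p0: "0 < Re (p 0)"
    and z1: "z1 \<in> unit_disc" "Re (p z1) \<le> 0"
  obtains z where "z \<in> unit_disc" "z \<noteq> 0" "Re (p z) = 0"
    and "\<And>w. norm w \<le> norm z \<Longrightarrow> 0 \<le> Re (p w)"
proof -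
  define K where "K = {w \<in> cball 0 (norm z1). Re (p w) \<le> 0}"
  have sub: "cball 0 (norm z1) \<subseteq> unit_disc"
    using z1 by auto
  have "closed K"
    unfolding K_def using continuous_on_subset[OF cont sub]
    by (intro continuous_on_closed_Collect_le continuous_intros) auto
  moreover have "bounded K"
    by (rule bounded_subset[OF bounded_cball[of 0 "norm z1"]]) (auto simp: K_def)
  ultimately have "compact K"
    by (simp add: compact_eq_bounded_closed)
  moreover have "z1 \<in> K"
    using z1 by (simp add: K_def)
  ultimately obtain z where z: "z \<in> K" and z_min: "\<And>w. w \<in> K \<Longrightarrow> norm z \<le> norm w"
    using continuous_attains_inf[OF _ _ continuous_on_norm_id, of K] by blast
  have in_disc: "z \<in> unit_disc" and nz: "z \<noteq> 0"
    using z sub p0 by (auto simp: K_def)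
  have pos: "0 < Re (p w)" if "norm w < norm z" for w
    using z_min[of w] z that by (auto simp: K_def not_le[symmetric])
  have nonneg: "0 \<le> Re (p w)" if "norm w \<le> norm z" for w
  proof (rule continuous_ge_on_closure[of "ball 0 (norm z)" "\<lambda>w. Re (p w)"])
    show "continuous_on (closure (ball 0 (norm z))) (\<lambda>w. Re (p w))"
      using nz in_disc by (intro continuous_intros continuous_on_subset[OF cont]) auto
  qed (use nz that pos in \<open>auto intro: less_imp_le\<close>)
  show thesis
    using that[OF in_disc nz _ nonneg] nonneg[of z] z by (auto simp: K_def)
qed

text \<open>The curve \<open>t \<mapsto> z e\<^bsup>it\<^esup>\<close> has derivative \<open>i w\<close> at its point \<open>w\<close>. So along it \<open>Re p\<close> has
  first derivative \<open>Re (i w p')\<close> and second derivative \<open>- Re (w p' + w\<^sup>2 p'')\<close>.\<close>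

lemma derivatives_at_minimum_of_Re:
  assumes p: "p holomorphic_on unit_disc" and z: "z \<in> unit_disc"
    and min: "\<And>w. norm w \<le> norm z \<Longrightarrow> Re (p z) \<le> Re (p w)"
  shows "Im (z * deriv p z) = 0" and "Re (z * deriv p z) \<le> 0"
    and "Re (z * deriv p z + z\<^sup>2 * deriv (deriv p) z) \<le> 0"
proof -
  have p': "deriv p holomorphic_on unit_disc"
    using p by (intro holomorphic_deriv) auto
  define c where "c t = z * exp (\<i> * of_real t)" for t :: real
  have c0: "c 0 = z" and norm_c: "norm (c t) = norm z" and c_disc: "c t \<in> unit_disc" for t
    using z by (auto simp: c_def norm_mult)
  have c: "(c has_vector_derivative \<i> * c t) (at t)" for t
  proof -
    have "((\<lambda>t. \<i> * of_real t) has_vector_derivative \<i>) (at t)"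
      by (auto intro!: derivative_eq_intros)
    moreover have "((\<lambda>w. z * exp w) has_field_derivative c t) (at (\<i> * of_real t))"
      by (auto simp: c_def intro!: derivative_eq_intros)
    ultimately have "((\<lambda>w. z * exp w) \<circ> (\<lambda>t. \<i> * of_real t) has_vector_derivative \<i> * c t) (at t)"
      by (rule field_vector_diff_chain_at)
    then show ?thesis
      by (simp add: c_def[abs_def] o_def)
  qed
  define g where "g t = Re (p (c t))" for t
  define g' where "g' t = Re (\<i> * c t * deriv p (c t))" for t
  have g: "(g has_field_derivative g' t) (at t)" for t
  proof -
    have "(p has_field_derivative deriv p (c t)) (at (c t))"
      using holomorphic_derivI[OF p _ c_disc] by auto
    from field_vector_diff_chain_at[OF c this]
    show ?thesis
      using has_field_derivative_Re by (fastforce simp: g_def[abs_def] g'_def o_def)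
  qed
  have g': "(g' has_field_derivative Re (- (z * deriv p z + z\<^sup>2 * deriv (deriv p) z))) (at 0)"
  proof -
    have "(deriv p has_field_derivative deriv (deriv p) z) (at z)"
      using holomorphic_derivI[OF p' _ z] by auto
    then have "((\<lambda>w. \<i> * w * deriv p w) has_field_derivative
        \<i> * deriv p z + \<i> * z * deriv (deriv p) z) (at z)"
      by (auto intro!: derivative_eq_intros)
    from field_vector_diff_chain_at[of c _ 0, OF c, unfolded c0, OF this]
    have "((\<lambda>t. \<i> * c t * deriv p (c t)) has_vector_derivative
        - (z * deriv p z + z\<^sup>2 * deriv (deriv p) z)) (at 0)"
      by (simp add: o_def algebra_simps power2_eq_square)
    then show ?thesis
      unfolding g'_def by (rule has_field_derivative_Re)
  qed
  have "g 0 \<le> g t" for t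
    using min[of "c t"] by (simp add: g_def c0 norm_c)
  note test = second_derivative_test_at_minimum[OF this g g']
  show "Im (z * deriv p z) = 0"
    using test(1) by (simp add: g'_def c0 algebra_simps)
  show "Re (z * deriv p z + z\<^sup>2 * deriv (deriv p) z) \<le> 0"
    using test(2) by simp
  show "Re (z * deriv p z) \<le> 0"
  proof (rule ccontr)
    assume pos: "\<not> Re (z * deriv p z) \<le> 0"
    define h where "h t = Re (p (of_real t * z))" for t
    have "((\<lambda>t. of_real t * z) has_vector_derivative z) (at 1)"
      by (auto intro!: derivative_eq_intros)
    moreover have "(p has_field_derivative deriv p z) (at (of_real 1 * z))"
      using holomorphic_derivI[OF p _ z] by auto
    ultimately have h: "(h has_field_derivative Re (z * deriv p z)) (at 1)"
      using field_vector_diff_chain_at[of "\<lambda>t. of_real t * z" z 1 p "deriv p z"]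
      unfolding h_def o_def by (intro has_field_derivative_Re) blast
    obtain e where e: "e > 0" and inc: "\<And>s. 0 < s \<Longrightarrow> s < e \<Longrightarrow> h (1 - s) < h 1"
      using DERIV_pos_inc_left[OF h] pos by (metis not_le)
    \<comment> \<open>With \<open>s \<le> 1\<close> the point \<open>(1 - s) z\<close> stays on the radius, where \<open>min\<close> applies.\<close>
    define s where "s = min (e / 2) 1"
    have "h 1 \<le> h (1 - s)"
      unfolding h_def using e
      by (auto simp: s_def norm_mult simp flip: of_real_diff intro!: min mult_left_le_one_le)
    then show False
      using inc[of s] e by (auto simp: s_def min_def split: if_splits)
  qed
qed

section \<open>The quotients as differential expressions in zf'/f\<close>

text \<open>The hypothesis on \<open>f f' / z\<close> says that \<open>f\<close> vanishes only at 0, where \<open>z f' / f\<close> has a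
  removable singularity, and that \<open>f'\<close> vanishes nowhere.\<close>

lemma nonzero_of_ff'_over_z:
  assumes "f \<in> class_A" and "\<forall>z\<in>unit_disc. ff'_over_z f z \<noteq> 0" and "z \<in> unit_disc"
  shows "deriv f z \<noteq> 0" and "z \<noteq> 0 \<Longrightarrow> f z \<noteq> 0"
  using assms by (auto simp: ff'_over_z_def class_A_def dest!: bspec[of _ _ z] split: if_splits)

lemma holomorphic_Q_ST:
  assumes f: "f \<in> class_A" and ne: "\<forall>z\<in>unit_disc. ff'_over_z f z \<noteq> 0"
  shows "Q_ST f holomorphic_on unit_disc"
proof -
  have hol: "f holomorphic_on unit_disc" and hol': "deriv f holomorphic_on unit_disc"
    using f by (auto simp: class_A_def intro!: holomorphic_deriv)
  have "(\<lambda>z. z * deriv f z / f z) holomorphic_on unit_disc - {0}"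
    using nonzero_of_ff'_over_z(2)[OF f ne]
    by (intro holomorphic_intros holomorphic_on_subset[OF hol] holomorphic_on_subset[OF hol']) auto
  then have punctured: "Q_ST f holomorphic_on unit_disc - {0}"
    by (rule holomorphic_transform) (auto simp: Q_ST_def)
  show ?thesis
  proof (rule no_isolated_singularity'[OF _ punctured])
    show "(Q_ST f \<longlongrightarrow> Q_ST f z) (at z within unit_disc)" if "z \<in> {0}" for z
      using that Lim_at_imp_Lim_at_within[OF Q_ST_tendsto_0[OF f]] by simp
  qed auto
qed

lemma Q_ST_nonzero:
  assumes "f \<in> class_A" and "\<forall>z\<in>unit_disc. ff'_over_z f z \<noteq> 0" and "z \<in> unit_disc"
  shows "Q_ST f z \<noteq> 0"
  using nonzero_of_ff'_over_z[OF assms] by (auto simp: Q_ST_def)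

text \<open>The logarithmic derivative of \<open>p = z f' / f\<close> is \<open>p' / p = 1 / z + f'' / f' - f' / f\<close>, that is,
  \<open>z p' / p = Q_CV f - p\<close>.\<close>

lemma Q_CV_eq_Q_ST:
  assumes f: "f \<in> class_A" and ne: "\<forall>z\<in>unit_disc. ff'_over_z f z \<noteq> 0"
    and z: "z \<in> unit_disc" "z \<noteq> 0"
  shows "Q_CV f z = Q_ST f z + z * deriv (Q_ST f) z / Q_ST f z"
proof -
  have hol: "f holomorphic_on unit_disc" and hol': "deriv f holomorphic_on unit_disc"
    using f by (auto simp: class_A_def intro!: holomorphic_deriv)
  have f': "(f has_field_derivative deriv f z) (at z)"
    and f'': "(deriv f has_field_derivative deriv (deriv f) z) (at z)"
    using holomorphic_derivI[OF hol _ z(1)] holomorphic_derivI[OF hol' _ z(1)] by auto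
  note nz = nonzero_of_ff'_over_z[OF f ne z(1)]
  have deriv_quot: "((\<lambda>w. w * deriv f w / f w) has_field_derivative
      ((deriv f z + z * deriv (deriv f) z) * f z - z * deriv f z * deriv f z) / (f z)\<^sup>2) (at z)"
    using nz z by (auto intro!: derivative_eq_intros f' f'' simp: power2_eq_square algebra_simps)
  have ev: "\<forall>\<^sub>F w in nhds z. w * deriv f w / f w = Q_ST f w"
    using t1_space_nhds[OF z(2)] by (auto simp: Q_ST_def elim!: eventually_mono)
  have "deriv (Q_ST f) z =
      ((deriv f z + z * deriv (deriv f) z) * f z - z * deriv f z * deriv f z) / (f z)\<^sup>2"
    using deriv_quot unfolding DERIV_cong_ev[OF refl ev refl] by (rule DERIV_imp_deriv)
  then show ?thesis
    using nz z by (simp add: Q_CV_def Q_ST_def field_simps power2_eq_square)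
qed

text \<open>Since \<open>f'' / f' = (Q_CV f - 1) / z\<close>, the Schwarzian derivative is \<open>((Q_CV f - 1) / z)' -
  ((Q_CV f - 1) / z)\<^sup>2 / 2\<close>.\<close>

lemma Q_SD_eq_Q_CV:
  assumes d: "(Q_CV f has_field_derivative d) (at z)" and z: "z \<noteq> 0"
  shows "Q_SD f z = z * d + (1 - (Q_CV f z)\<^sup>2) / 2"
proof -
  have quot: "deriv (deriv f) w / deriv f w = (Q_CV f w - 1) / w" if "w \<noteq> 0" for w
    using that by (simp add: Q_CV_def)
  have deriv_quot: "((\<lambda>w. (Q_CV f w - 1) / w) has_field_derivative (d * z - (Q_CV f z - 1)) / z\<^sup>2) (at z)"
    using z by (auto intro!: derivative_eq_intros d simp: power2_eq_square)
  have ev: "\<forall>\<^sub>F w in nhds z. (Q_CV f w - 1) / w = deriv (deriv f) w / deriv f w"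
    using t1_space_nhds[OF z] by (auto simp: quot elim!: eventually_mono)
  have "deriv (\<lambda>w. deriv (deriv f) w / deriv f w) z = (d * z - (Q_CV f z - 1)) / z\<^sup>2"
    using deriv_quot unfolding DERIV_cong_ev[OF refl ev refl] by (rule DERIV_imp_deriv)
  then show ?thesis
    unfolding Q_SD_def schwarzian_def quot[OF z]
    using z by (simp add: divide_simps power2_eq_square) (simp add: algebra_simps)
qed

lemma Q_SD_eq_Q_ST:
  assumes f: "f \<in> class_A" and ne: "\<forall>z\<in>unit_disc. ff'_over_z f z \<noteq> 0"
    and z: "z \<in> unit_disc" "z \<noteq> 0"
  shows "Q_SD f z = z * deriv (Q_ST f) z
    + (z * deriv (Q_ST f) z + z\<^sup>2 * deriv (deriv (Q_ST f)) z) / Q_ST f z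
    - (z * deriv (Q_ST f) z / Q_ST f z)\<^sup>2 + (1 - (Q_CV f z)\<^sup>2) / 2"
proof -
  let ?p = "Q_ST f"
  have hol: "?p holomorphic_on unit_disc" and hol': "deriv ?p holomorphic_on unit_disc"
    using holomorphic_Q_ST[OF f ne] by (auto intro!: holomorphic_deriv)
  have p': "(?p has_field_derivative deriv ?p z) (at z)"
    and p'': "(deriv ?p has_field_derivative deriv (deriv ?p) z) (at z)"
    using holomorphic_derivI[OF hol _ z(1)] holomorphic_derivI[OF hol' _ z(1)] by auto
  note nz = Q_ST_nonzero[OF f ne z(1)]
  have deriv_sum: "((\<lambda>w. ?p w + w * deriv ?p w / ?p w) has_field_derivative deriv ?p z
      + ((deriv ?p z + z * deriv (deriv ?p) z) * ?p z - z * deriv ?p z * deriv ?p z) / (?p z)\<^sup>2) (at z)"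
    using nz by (auto intro!: derivative_eq_intros p' p'' simp: power2_eq_square algebra_simps)
  have ev: "\<forall>\<^sub>F w in nhds z. ?p w + w * deriv ?p w / ?p w = Q_CV f w"
    using eventually_nhds_in_open[of "unit_disc - {0}" z] z
    by (auto simp: Q_CV_eq_Q_ST[OF f ne] open_delete elim!: eventually_mono)
  have "(Q_CV f has_field_derivative deriv ?p z
      + ((deriv ?p z + z * deriv (deriv ?p) z) * ?p z - z * deriv ?p z * deriv ?p z) / (?p z)\<^sup>2) (at z)"
    using deriv_sum unfolding DERIV_cong_ev[OF refl ev refl] .
  note SD = Q_SD_eq_Q_CV[OF this z(2)]
  have "z * (a + ((a + z * b) * p - z * a * a) / p\<^sup>2)
      = z * a + (z * a + z\<^sup>2 * b) / p - (z * a / p)\<^sup>2" if "p \<noteq> 0" for a b p :: complex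
    using that by (simp add: divide_simps power2_eq_square) (simp add: algebra_simps)
  from this[OF nz, of "deriv ?p z" "deriv (deriv ?p) z"] show ?thesis
    unfolding SD by (simp only:)
qed

section \<open>The contradiction at the first zero\<close>

text \<open>Since \<open>p = Q_ST f\<close> has no zeros, \<open>\<rho> = Im (p z)\<close> is not 0. In terms of \<open>\<rho>\<close> and \<open>\<sigma> = z p' \<le> 0\<close>, the value \<open>Q_CV f z\<close> is \<open>k\<close> times
  \<open>p z\<close> with \<open>k = 1 - \<sigma> / \<rho>\<^sup>2 \<ge> 0\<close>. Hence \<open>Re (Q_SD Q_CV)\<close> is \<open>k\<close> times
  \<open>Re (Q_SD Q_ST)\<close>, and the latter is \<open>Re (z p' + z\<^sup>2 p'')\<close>: the other terms
  of \<open>Q_SD\<close> are real at \<open>z\<close>, and \<open>Q_ST\<close> is imaginary.\<close>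

lemma Q_values_at_first_zero:
  assumes f: "f \<in> class_A" and ne: "\<forall>z\<in>unit_disc. ff'_over_z f z \<noteq> 0"
    and z: "z \<in> unit_disc" "z \<noteq> 0" and zero: "Re (Q_ST f z) = 0"
    and nonneg: "\<And>w. norm w \<le> norm z \<Longrightarrow> 0 \<le> Re (Q_ST f w)"
  shows "Re (Q_CV f z) = 0" and "Re (Q_SD f z * Q_ST f z) \<le> 0" and "Re (Q_SD f z * Q_CV f z) \<le> 0"
proof -
  define \<rho> where "\<rho> = Im (Q_ST f z)"
  define \<sigma> where "\<sigma> = Re (z * deriv (Q_ST f) z)"
  define m where "m = z * deriv (Q_ST f) z + z\<^sup>2 * deriv (deriv (Q_ST f)) z"
  define k where "k = 1 - \<sigma> / \<rho>\<^sup>2"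
  note derivs = derivatives_at_minimum_of_Re[OF holomorphic_Q_ST[OF f ne] z(1), unfolded zero, OF nonneg]
  have ST: "Q_ST f z = \<i> * of_real \<rho>" and d: "z * deriv (Q_ST f) z = of_real \<sigma>"
    using zero derivs(1) by (auto simp: complex_eq_iff \<rho>_def \<sigma>_def)
  have "\<rho> \<noteq> 0"
    using Q_ST_nonzero[OF f ne z(1)] ST by auto
  have "\<sigma> \<le> 0" and m: "Re m \<le> 0"
    using derivs(2,3) by (simp_all add: \<sigma>_def m_def)
  then have k: "0 \<le> k"
    by (auto simp: k_def divide_le_0_iff intro: order_trans[of _ 0])
  have CV: "Q_CV f z = of_real k * Q_ST f z"
    unfolding Q_CV_eq_Q_ST[OF f ne z] d ST k_def
    using \<open>\<rho> \<noteq> 0\<close> by (simp add: field_simps power2_eq_square)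
  have "Q_SD f z = of_real \<sigma> + m / (\<i> * of_real \<rho>) - (of_real \<sigma> / (\<i> * of_real \<rho>))\<^sup>2
      + (1 - (of_real k * (\<i> * of_real \<rho>))\<^sup>2) / 2"
    unfolding Q_SD_eq_Q_ST[OF f ne z] CV m_def d ST ..
  also have "\<dots> = of_real (\<sigma> + (\<sigma> / \<rho>)\<^sup>2 + (1 + (k * \<rho>)\<^sup>2) / 2) + m / (\<i> * of_real \<rho>)"
    by (simp add: power_mult_distrib power_divide)
  finally have "Q_SD f z * Q_ST f z =
      of_real (\<sigma> + (\<sigma> / \<rho>)\<^sup>2 + (1 + (k * \<rho>)\<^sup>2) / 2) * (\<i> * of_real \<rho>) + m"
    unfolding ST using \<open>\<rho> \<noteq> 0\<close> by (simp add: distrib_right)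
  then have Re_SD_ST: "Re (Q_SD f z * Q_ST f z) = Re m"
    by simp
  show "Re (Q_SD f z * Q_ST f z) \<le> 0"
    using Re_SD_ST m by simp
  have "Re (Q_SD f z * Q_CV f z) = k * Re (Q_SD f z * Q_ST f z)"
    by (simp add: CV algebra_simps)
  then show "Re (Q_SD f z * Q_CV f z) \<le> 0"
    unfolding Re_SD_ST using k m by (simp only: mult_nonneg_nonpos)
  show "Re (Q_CV f z) = 0"
    by (simp add: CV ST)
qed

lemma Re_combination_nonpos:
  assumes "\<alpha> \<le> 1" "0 \<le> \<beta>" and "Re A = 0" "Re B = 0" "Re (S * C) \<le> 0"
  shows "Re (of_real \<alpha> * A + (1 - of_real \<alpha>) * B\<^sup>2 + of_real \<beta> * S * C) \<le> 0"
proof -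
  have "B\<^sup>2 = of_real (- (Im B)\<^sup>2)"
    using \<open>Re B = 0\<close> by (simp add: complex_eq_iff power2_eq_square)
  then have "Re ((1 - of_real \<alpha>) * B\<^sup>2) = (1 - \<alpha>) * - (Im B)\<^sup>2"
    by simp
  moreover have "(1 - \<alpha>) * - (Im B)\<^sup>2 \<le> 0"
    using \<open>\<alpha> \<le> 1\<close> by (intro mult_nonneg_nonpos) auto
  moreover have "Re (of_real \<beta> * S * C) = \<beta> * Re (S * C)"
    by (simp add: mult.assoc)
  moreover have "\<beta> * Re (S * C) \<le> 0"
    using assms by (intro mult_nonneg_nonpos)
  ultimately show ?thesis
    using \<open>Re A = 0\<close> by simp
qed

theorem theorem2p9:
  fixes \<alpha> \<beta> :: real and f :: "complex \<Rightarrow> complex"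
  assumes "0 \<le> \<alpha>" and "\<alpha> \<le> 1" and "0 \<le> \<beta>"
    and "f \<in> class_A"
    and "\<forall>z\<in>unit_disc. ff'_over_z f z \<noteq> 0"
    and
      "(\<forall>z\<in>unit_disc. Re (of_real \<alpha> * Q_ST f z + (1 - of_real \<alpha>) * (Q_ST f z)\<^sup>2 + of_real \<beta> * Q_SD f z * Q_CV f z) > 0) \<or>
       (\<forall>z\<in>unit_disc. Re (of_real \<alpha> * Q_ST f z + (1 - of_real \<alpha>) * (Q_ST f z)\<^sup>2 + of_real \<beta> * Q_SD f z * Q_ST f z) > 0) \<or>
       (\<forall>z\<in>unit_disc. Re (of_real \<alpha> * Q_ST f z + (1 - of_real \<alpha>) * (Q_CV f z)\<^sup>2 + of_real \<beta> * Q_SD f z * Q_ST f z) > 0) \<or>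
       (\<forall>z\<in>unit_disc. Re (of_real \<alpha> * Q_CV f z + (1 - of_real \<alpha>) * (Q_ST f z)\<^sup>2 + of_real \<beta> * Q_SD f z * Q_ST f z) > 0) \<or>
       (\<forall>z\<in>unit_disc. Re (of_real \<alpha> * Q_CV f z + (1 - of_real \<alpha>) * (Q_CV f z)\<^sup>2 + of_real \<beta> * Q_SD f z * Q_CV f z) > 0) \<or>
       (\<forall>z\<in>unit_disc. Re (of_real \<alpha> * Q_CV f z + (1 - of_real \<alpha>) * (Q_ST f z)\<^sup>2 + of_real \<beta> * Q_SD f z * Q_CV f z) > 0) \<or>
       (\<forall>z\<in>unit_disc. Re (of_real \<alpha> * Q_ST f z + (1 - of_real \<alpha>) * (Q_CV f z)\<^sup>2 + of_real \<beta> * Q_SD f z * Q_CV f z) > 0) \<or>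
       (\<forall>z\<in>unit_disc. Re (of_real \<alpha> * Q_CV f z + (1 - of_real \<alpha>) * (Q_CV f z)\<^sup>2 + of_real \<beta> * Q_SD f z * Q_ST f z) > 0)"
  shows "starlike_fun f"
proof (rule ccontr)
  note ST = holomorphic_Q_ST[OF assms(4,5)]
  assume "\<not> starlike_fun f"
  then obtain z1 where "z1 \<in> unit_disc" "Re (Q_ST f z1) \<le> 0"
    using assms(4) by (auto simp: starlike_fun_def not_less)
  note z1 = this
  have "0 < Re (Q_ST f 0)"
    by (simp add: Q_ST_def)
  then obtain z where z: "z \<in> unit_disc" "z \<noteq> 0" and zero: "Re (Q_ST f z) = 0"
    and nonneg: "\<And>w. norm w \<le> norm z \<Longrightarrow> 0 \<le> Re (Q_ST f w)"
    by (rule first_zero_of_Re[OF holomorphic_on_imp_continuous_on[OF ST] _ z1]) (rule that)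
  note at_z = Q_values_at_first_zero[OF assms(4,5) z zero nonneg]
  have not_pos: "\<not> 0 < Re (of_real \<alpha> * A + (1 - of_real \<alpha>) * B\<^sup>2 + of_real \<beta> * Q_SD f z * C)"
    if "A \<in> {Q_ST f z, Q_CV f z}" "B \<in> {Q_ST f z, Q_CV f z}" "C \<in> {Q_ST f z, Q_CV f z}" for A B C
  proof -
    have "Re A = 0" "Re B = 0" "Re (Q_SD f z * C) \<le> 0"
      using that zero at_z by blast+
    then show ?thesis
      unfolding not_less by (rule Re_combination_nonpos[OF assms(2,3)])
  qed
  from assms(6) show False
  proof (elim disjE)
  qed (drule bspec[OF _ z(1)], erule not_pos[THEN notE, rotated 3], blast, blast, blast)+
qed

end
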